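(* Let $\varrho$ be a coherent risk measure on $L_d^\infty$ with values in $\mathbb{R}^d$ equipped with the reversed coordinatewise order, associated with $f(x)=-x$, where $K=\mathbb{R}^d_+$. Let $\mathcal{A}=\{X\in L_d^\infty:\varrho(X)\leq 0 \text{ coordinatewise}\}$ be its acceptance set and $$\mathcal{A}^*=\bigcap_{X\in\mathcal{A}}\{\mu:\ \mathbf{E}_\mu(X)\geq 0\}$$ its polar set. Then $$\varrho(X)=\Big(-\inf_{\mu_1\in\mathcal{A}^*_1}\mathbf{E}_{\mu_1}(X_1),\dots,-\inf_{\mu_d\in\mathcal{A}^*_d}\mathbf{E}_{\mu_d}(X_d)\Big),\qquad X=(X_1,\dots,X_d)\in L_d^\infty,$$ where $\mathcal{A}^*_i$ is the family of normalised measures $\mu_i$ (i.e. $\mu_i(\Omega)=1$) such that $(0,\dots,0,\mu_i,0,\dots,0)\in\mathcal{A}^*$ (with $\mu_i$ at position $i$), $i=1,\dots,d$. Consequently, $\varrho(X)$ can be represented as the vector $(\rho_1(X_1),\dots,\rho_d(X_d))$ composed of univariate coherent risk measures $\rho_1,\dots,\rho_d$ of the marginals of $X$.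
   Context: $L_d^\infty$ is the set of essentially bounded $d$-dimensional random vectors on a probability space $(\Omega,\mathfrak{F},\mathbf{P})$. Its dual space is the family of finitely additive bounded vector measures $\mu=(\mu_1,\dots,\mu_d)$ on $(\Omega,\mathfrak{F})$ (vanishing on $\mathbf{P}$-null sets), acting by $\mathbf{E}_\mu(X)=\sum_{i=1}^d\int X_i\,d\mu_i$; the $\mu$ in the definition of $\mathcal{A}^*$ range over this dual space, and $\mathbf{E}_{\mu_i}(X_i)=\int X_i\,d\mu_i$. Write $\leq$ for the coordinatewise order on $\mathbb{R}^d$. In this setting, $\varrho:L_d^\infty\to\mathbb{R}^d$ being a coherent risk measure associated with $f(x)=-x$ means: $\varrho(X)=-x$ if $X=x$ a.s.; (R1) $\varrho(X+y)=\varrho(X)-y$ for all $y\in\mathbb{R}^d$; (R2) $\varrho(X)\leq\varrho(Y)$ whenever $Y\leq X$ a.s.; (R3) $\varrho(tX)=t\varrho(X)$ for all $t>0$; (R4) $\varrho(X+Y)\leq\varrho(X)+\varrho(Y)$ for all $X,Y\in L_d^\infty$. A univariate coherent risk measure is the same notion for $d=1$. *)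

theory Defs
  imports "HOL-Probability.Probability"
begin

text \<open>
  Elements of \<open>L\<^sup>\<infinity>\<close> are represented by measurable functions rather than by equivalence classes.
  Monotonicity (R2) below forces a risk measure to agree on functions that are equal almost surely.
\<close>

definition Linf :: "'a measure \<Rightarrow> ('a \<Rightarrow> 'b::euclidean_space) set" where
  "Linf M = {X \<in> borel_measurable M. \<exists>C. AE \<omega> in M. norm (X \<omega>) \<le> C}"

text \<open>
  The orders on \<open>real\<close> and on \<open>real ^ 'd\<close> (coordinatewise) are both instances of
  \<^class>\<open>ordered_euclidean_space\<close>, so the univariate notion is the instance \<open>'b = real\<close>.
  All inequalities use the ordinary order; the reversal of the order on the values of the risk
  measure is already accounted for in the directions of (R2) and (R4), the third and fifth clauses.
\<close>

definition coherent_risk_measure ::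
    "'a measure \<Rightarrow> (('a \<Rightarrow> 'b::ordered_euclidean_space) \<Rightarrow> 'b) \<Rightarrow> bool" where
  "coherent_risk_measure M \<rho> \<longleftrightarrow>
     (\<forall>X\<in>Linf M. \<forall>x. (AE \<omega> in M. X \<omega> = x) \<longrightarrow> \<rho> X = - x) \<and>
     (\<forall>X\<in>Linf M. \<forall>y. \<rho> (\<lambda>\<omega>. X \<omega> + y) = \<rho> X - y) \<and>
     (\<forall>X\<in>Linf M. \<forall>Y\<in>Linf M. (AE \<omega> in M. Y \<omega> \<le> X \<omega>) \<longrightarrow> \<rho> X \<le> \<rho> Y) \<and>
     (\<forall>X\<in>Linf M. \<forall>t>0. \<rho> (\<lambda>\<omega>. t *\<^sub>R X \<omega>) = t *\<^sub>R \<rho> X) \<and>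
     (\<forall>X\<in>Linf M. \<forall>Y\<in>Linf M. \<rho> (\<lambda>\<omega>. X \<omega> + Y \<omega>) \<le> \<rho> X + \<rho> Y)"

definition acceptance_set ::
    "'a measure \<Rightarrow> (('a \<Rightarrow> 'b::ordered_euclidean_space) \<Rightarrow> 'b) \<Rightarrow> ('a \<Rightarrow> 'b) set" where
  "acceptance_set M \<rho> = {X \<in> Linf M. \<rho> X \<le> 0}"

text \<open>
  Bounded finitely additive (signed or vector) measures vanishing on null sets.  They are total
  functions on \<open>'a set\<close>; values outside \<open>sets M\<close> are unconstrained and never used.
\<close>

definition ba :: "'a measure \<Rightarrow> ('a set \<Rightarrow> 'b::real_normed_vector) set" where
  "ba M = {\<mu>. additive (sets M) \<mu> \<and> bounded (\<mu> ` sets M) \<and> (\<forall>A\<in>null_sets M. \<mu> A = 0)}"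

definition fa_simple_integral :: "'a measure \<Rightarrow> ('a set \<Rightarrow> real) \<Rightarrow> ('a \<Rightarrow> real) \<Rightarrow> real" where
  "fa_simple_integral M \<mu> s = (\<Sum>y\<in>s ` space M. y * \<mu> (s -` {y} \<inter> space M))"

text \<open>
  The integral against a finitely additive measure: the limit of the integrals of simple functions
  that converge in the essential supremum norm.  For \<open>\<mu> \<in> ba M\<close> and \<open>f \<in> Linf M\<close> such a sequence
  exists and the limit does not depend on its choice.
\<close>

definition has_fa_integral ::
    "'a measure \<Rightarrow> ('a set \<Rightarrow> real) \<Rightarrow> ('a \<Rightarrow> real) \<Rightarrow> real \<Rightarrow> bool" where
  "has_fa_integral M \<mu> f I \<longleftrightarrow>
     (\<exists>s. (\<forall>n. simple_function M (s n)) \<and>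
          (\<forall>e>0. \<forall>\<^sub>F n in sequentially. AE \<omega> in M. \<bar>s n \<omega> - f \<omega>\<bar> \<le> e) \<and>
          (\<lambda>n. fa_simple_integral M \<mu> (s n)) \<longlonglongrightarrow> I)"

definition fa_integral :: "'a measure \<Rightarrow> ('a set \<Rightarrow> real) \<Rightarrow> ('a \<Rightarrow> real) \<Rightarrow> real" where
  "fa_integral M \<mu> f = (THE I. has_fa_integral M \<mu> f I)"

definition fa_expectation ::
    "'a measure \<Rightarrow> ('a set \<Rightarrow> real ^ 'd::finite) \<Rightarrow> ('a \<Rightarrow> real ^ 'd) \<Rightarrow> real" where
  "fa_expectation M \<mu> X = (\<Sum>i\<in>UNIV. fa_integral M (\<lambda>A. \<mu> A $ i) (\<lambda>\<omega>. X \<omega> $ i))"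

definition polar_set ::
    "'a measure \<Rightarrow> ('a \<Rightarrow> real ^ 'd::finite) set \<Rightarrow> ('a set \<Rightarrow> real ^ 'd) set" where
  "polar_set M \<A> = (\<Inter>X\<in>\<A>. {\<mu> \<in> ba M. fa_expectation M \<mu> X \<ge> 0})"

text \<open>\<open>axis i (\<nu> A)\<close> is the vector with \<open>\<nu> A\<close> at position \<open>i\<close> and zeros elsewhere.\<close>

definition polar_marginal ::
    "'a measure \<Rightarrow> ('a \<Rightarrow> real ^ 'd::finite) set \<Rightarrow> 'd \<Rightarrow> ('a set \<Rightarrow> real) set" where
  "polar_marginal M \<A> i =
     {\<nu> \<in> ba M. \<nu> (space M) = 1 \<and> (\<lambda>A. axis i (\<nu> A)) \<in> polar_set M \<A>}"

end

(* Subadditivity and monotonicity give rho(X)_i <= rho(Y)_i as soon as X_i = Y_i: the difference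
   X - Y is bounded below by a constant vector whose i-th entry is 0, so rho(X - Y)_i <= 0.  Hence
   rho(X)_i = r_i(X_i) for a univariate coherent risk measure r_i.  By Hahn-Banach there is a linear
   l with -r_i(f) <= l(f) <= r_i(-f) and l(X_i) = -r_i(X_i); it is integration against the finitely
   additive measure A |-> l(1_A), which attains the infimum.  The other inequality holds because
   X + rho(X) is acceptable. *)
theory Submission
  imports Defs "HOL-Library.Function_Algebras"
begin

section \<open>The Hahn-Banach theorem on a subspace\<close>

text \<open>The axioms of a coherent risk measure give continuity only for the essential supremum
  norm, whose dual is \<open>ba M\<close>; this is why finitely additive measures appear. The
  functional is chosen anew for each random vector and made to touch its lower bound there, so a
  single measure settles one of the two inequalities. Two facts shape the rest.
  \<open>Linf M\<close> is a set inside the space of all real functions and not a type, so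
  Hahn-Banach is stated relative to a carrier \<open>V\<close>. And an integral against a finitely
  additive measure is a definite description over limits, so every statement about it rests on
  existence and uniqueness of the limit; both come from one estimate by the total variation. Almost
  sure equality is never quotiented out: a functional bounded by the essential supremum norm
  respects it automatically.\<close>

locale real_subspace = vector_space scale
  for scale :: "real \<Rightarrow> 'v::ab_group_add \<Rightarrow> 'v" +
  fixes V :: "'v set"
  assumes subspace_V: "subspace V"
begin

definition sublinear :: "('v \<Rightarrow> real) \<Rightarrow> bool" where
  "sublinear p \<longleftrightarrow>
     (\<forall>x\<in>V. \<forall>y\<in>V. p (x + y) \<le> p x + p y) \<and> (\<forall>x\<in>V. \<forall>t>0. p (scale t x) = t * p x)"

text \<open>The reverse scaling inequality comes from applying the hypothesis to
  \<open>scale t x\<close> with factor \<open>1 / t\<close>. For functionals defined as infima only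
  the assumed direction is direct.\<close>

lemma sublinearI:
  assumes add: "\<And>x y. x \<in> V \<Longrightarrow> y \<in> V \<Longrightarrow> p (x + y) \<le> p x + p y"
    and scale: "\<And>x t. x \<in> V \<Longrightarrow> t > 0 \<Longrightarrow> p (scale t x) \<le> t * p x"
  shows "sublinear p"
proof -
  have "p (scale t x) = t * p x" if "x \<in> V" "t > 0" for x t
  proof (rule antisym)
    have "p x = p (scale (1 / t) (scale t x))"
      using that by simp
    also have "\<dots> \<le> (1 / t) * p (scale t x)"
      using that subspace_V by (intro scale) (auto simp: subspace_def)
    finally show "t * p x \<le> p (scale t x)"
      using that by (simp add: field_simps)
  qed (use that scale in auto)
  then show ?thesis
    using add by (auto simp: sublinear_def)
qed

lemma sublinear_zero: "sublinear p \<Longrightarrow> p 0 = 0"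
proof -
  assume "sublinear p"
  then have "p (scale 2 0) = 2 * p 0"
    using subspace_0[OF subspace_V] by (auto simp: sublinear_def simp del: scale_zero_right)
  then show ?thesis by simp
qed

lemma sublinear_scale: "sublinear p \<Longrightarrow> x \<in> V \<Longrightarrow> t \<ge> 0 \<Longrightarrow> p (scale t x) = t * p x"
  using sublinear_zero[of p] by (cases "t = 0") (auto simp: sublinear_def)

lemma sublinear_add: "sublinear p \<Longrightarrow> x \<in> V \<Longrightarrow> y \<in> V \<Longrightarrow> p (x + y) \<le> p x + p y"
  by (simp add: sublinear_def)

text \<open>Subadditivity at 0 = x + (- x). It gives all sublinear functionals below a common
  \<open>p\<close> the joint lower bound \<open>- p (- x)\<close>, which makes pointwise infima over
  chains meaningful.\<close>

lemma sublinear_lower: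
  assumes "sublinear p" "x \<in> V"
  shows "- p (- x) \<le> p x"
  using sublinear_add[of p x "-x"] sublinear_zero[of p] assms subspace_neg[OF subspace_V] by simp

text \<open>
  The tilted functional lies below \<open>p\<close>.  A minimal sublinear functional therefore equals all of
  its tilts, which makes it superadditive (hence linear), while tilting \<open>p\<close> itself towards \<open>z\<close>
  before minimising forces the value \<open>p z\<close> at \<open>z\<close>.
\<close>

definition tilt :: "('v \<Rightarrow> real) \<Rightarrow> 'v \<Rightarrow> 'v \<Rightarrow> real" where
  "tilt p z y = (INF t\<in>{0..}. p (y + scale t z) - t * p z)"

context
  fixes p z
  assumes p: "sublinear p" and z: "z \<in> V"
begin

lemma tilt_le:
  assumes y: "y \<in> V" and "t \<ge> 0"
  shows "tilt p z y \<le> p (y + scale t z) - t * p z"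
  unfolding tilt_def
proof (rule cINF_lower)
  \<comment> \<open>The bound is uniform in \<open>t\<close>: splitting \<open>scale t z\<close> as
    \<open>(y + scale t z) + (- y)\<close> costs only the constant \<open>p (- y)\<close>.\<close>
  have "- p (- y) \<le> p (y + scale t z) - t * p z" if "t \<ge> 0" for t
  proof -
    have "p (scale t z) \<le> p (y + scale t z) + p (- y)"
      using sublinear_add[OF p, of "y + scale t z" "- y"] y z subspace_V
      by (simp add: subspace_add subspace_scale subspace_neg)
    then show ?thesis
      using sublinear_scale[OF p z that] by simp
  qed
  then show "bdd_below ((\<lambda>t. p (y + scale t z) - t * p z) ` {0..})"
    by (intro bdd_belowI2[of _ "- p (- y)"]) auto
qed (use assms in simp)

lemma tilt_greatest:
  "(\<And>t. t \<ge> 0 \<Longrightarrow> c \<le> p (y + scale t z) - t * p z) \<Longrightarrow> c \<le> tilt p z y"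
  unfolding tilt_def by (intro cINF_greatest) auto

lemma tilt_le_self: "y \<in> V \<Longrightarrow> tilt p z y \<le> p y"
  using tilt_le[of y 0] by simp

text \<open>Parameters add: \<open>t\<close> for one summand and \<open>u\<close> for the other
  yield the candidate \<open>t + u\<close> for the sum, and the two infima are then taken one at a
  time. Under multiplication by \<open>c\<close> the parameter \<open>t\<close> becomes
  \<open>c * t\<close>.\<close>

lemma sublinear_tilt: "sublinear (tilt p z)"
proof (rule sublinearI)
  fix x y assume xy: "x \<in> V" "y \<in> V"
  have *: "tilt p z (x + y) \<le> (p (x + scale t z) - t * p z) + (p (y + scale u z) - u * p z)"
    if "t \<ge> 0" "u \<ge> 0" for t u
  proof -
    have "tilt p z (x + y) \<le> p (x + y + scale (t + u) z) - (t + u) * p z"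
      using that xy subspace_V by (intro tilt_le) (auto simp: subspace_add)
    also have "x + y + scale (t + u) z = (x + scale t z) + (y + scale u z)"
      by (simp add: scale_left_distrib ac_simps)
    also have "p \<dots> \<le> p (x + scale t z) + p (y + scale u z)"
      using xy z subspace_V by (intro sublinear_add[OF p]) (auto simp: subspace_add subspace_scale)
    finally show ?thesis
      by (simp add: algebra_simps)
  qed
  have "tilt p z (x + y) - (p (x + scale t z) - t * p z) \<le> tilt p z y" if "t \<ge> 0" for t
    using *[OF that] by (intro tilt_greatest) (simp add: algebra_simps)
  then have "tilt p z (x + y) - tilt p z y \<le> tilt p z x"
    by (intro tilt_greatest) (simp add: algebra_simps)
  then show "tilt p z (x + y) \<le> tilt p z x + tilt p z y"
    by simp
next
  fix x and c :: real assume x: "x \<in> V" and c: "c > 0"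
  have "(1 / c) * tilt p z (scale c x) \<le> p (x + scale t z) - t * p z" if "t \<ge> 0" for t
  proof -
    have "tilt p z (scale c x) \<le> p (scale c x + scale (c * t) z) - (c * t) * p z"
      using that c x subspace_V by (intro tilt_le) (auto simp: subspace_scale)
    also have "scale c x + scale (c * t) z = scale c (x + scale t z)"
      by (simp add: scale_right_distrib)
    also have "p \<dots> = c * p (x + scale t z)"
      using x z c subspace_V by (intro sublinear_scale[OF p]) (auto simp: subspace_add subspace_scale)
    finally show ?thesis
      using c by (simp add: field_simps)
  qed
  then have "(1 / c) * tilt p z (scale c x) \<le> tilt p z x"
    by (rule tilt_greatest)
  then show "tilt p z (scale c x) \<le> c * tilt p z x"
    using c by (simp add: field_simps)
qed

lemma tilt_add_le: "y \<in> V \<Longrightarrow> tilt p z y + p z \<le> p (y + z)"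
  using tilt_le[of y 1] by simp

end

text \<open>An infimum of sublinear functionals may fail to be subadditive, because the two summands
  can be nearly minimised by different members. In a chain the smaller of these two members serves
  both summands.\<close>

lemma sublinear_INF_chain:
  assumes ne: "C \<noteq> {}"
    and sub: "\<And>q. q \<in> C \<Longrightarrow> sublinear q"
    and le: "\<And>q x. q \<in> C \<Longrightarrow> x \<in> V \<Longrightarrow> q x \<le> p x"
    and chain: "\<And>q q'. q \<in> C \<Longrightarrow> q' \<in> C \<Longrightarrow> (\<forall>x\<in>V. q x \<le> q' x) \<or> (\<forall>x\<in>V. q' x \<le> q x)"
  shows "sublinear (\<lambda>x. INF q\<in>C. q x)"
    and "\<And>q x. q \<in> C \<Longrightarrow> x \<in> V \<Longrightarrow> (INF q\<in>C. q x) \<le> q x"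
proof -
  show lower: "(INF q\<in>C. q x) \<le> q x" if "q \<in> C" "x \<in> V" for q x
  proof (rule cINF_lower)
    have "- p (- x) \<le> q x" if "q \<in> C" for q
      using sublinear_lower[OF sub[OF that] \<open>x \<in> V\<close>] le[OF that, of "- x"] \<open>x \<in> V\<close>
        subspace_neg[OF subspace_V, of x] by simp
    then show "bdd_below ((\<lambda>q. q x) ` C)"
      by (intro bdd_belowI2[of _ "- p (- x)"])
  qed (rule \<open>q \<in> C\<close>)
  show "sublinear (\<lambda>x. INF q\<in>C. q x)"
  proof (rule sublinearI)
    fix x y assume xy: "x \<in> V" "y \<in> V"
    have *: "(INF q\<in>C. q (x + y)) \<le> q x + q' y" if q: "q \<in> C" "q' \<in> C" for q q'
    proof -
      obtain r where r: "r \<in> C" "r x \<le> q x" "r y \<le> q' y"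
        using chain[OF q] q xy by blast
      have "(INF q\<in>C. q (x + y)) \<le> r (x + y)"
        using r xy subspace_V by (intro lower) (auto simp: subspace_add)
      also have "\<dots> \<le> r x + r y"
        using sub[OF r(1)] xy by (intro sublinear_add)
      finally show ?thesis
        using r by simp
    qed
    have "(INF q\<in>C. q (x + y)) - q x \<le> (INF q\<in>C. q y)" if "q \<in> C" for q
      using *[OF that] by (intro cINF_greatest ne) (simp add: algebra_simps)
    then have "(INF q\<in>C. q (x + y)) - (INF q\<in>C. q y) \<le> (INF q\<in>C. q x)"
      by (intro cINF_greatest ne) (simp add: algebra_simps)
    then show "(INF q\<in>C. q (x + y)) \<le> (INF q\<in>C. q x) + (INF q\<in>C. q y)"
      by simp
  next
    fix x and t :: real assume xt: "x \<in> V" "t > 0"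
    have "(1 / t) * (INF q\<in>C. q (scale t x)) \<le> q x" if "q \<in> C" for q
    proof -
      have "(INF q\<in>C. q (scale t x)) \<le> q (scale t x)"
        using that xt subspace_V by (intro lower) (auto simp: subspace_scale)
      then show ?thesis
        using sublinear_scale[OF sub[OF that], of x t] xt by (simp add: field_simps)
    qed
    then have "(1 / t) * (INF q\<in>C. q (scale t x)) \<le> (INF q\<in>C. q x)"
      using ne by (intro cINF_greatest) auto
    then show "(INF q\<in>C. q (scale t x)) \<le> t * (INF q\<in>C. q x)"
      using xt by (simp add: field_simps)
  qed
qed

lemma minimal_sublinear_exists:
  assumes p: "sublinear p"
  obtains l where "sublinear l" "\<And>x. x \<in> V \<Longrightarrow> l x \<le> p x"
    "\<And>q x. sublinear q \<Longrightarrow> (\<And>y. y \<in> V \<Longrightarrow> q y \<le> l y) \<Longrightarrow> x \<in> V \<Longrightarrow> q x = l x"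
proof -
  \<comment> \<open>Values off \<open>V\<close> are fixed to make the comparison on \<open>V\<close> antisymmetric.\<close>
  define A where "A = {q. sublinear q \<and> (\<forall>x\<in>V. q x \<le> p x) \<and> (\<forall>x. x \<notin> V \<longrightarrow> q x = 0)}"
  \<comment> \<open>The order is reversed: the maximal element given by Zorn's lemma is a minimal
    functional, and the upper bounds of nonempty chains are pointwise infima.\<close>
  define P where "P q q' \<longleftrightarrow> (\<forall>x\<in>V. q' x \<le> q x)" for q q' :: "'v \<Rightarrow> real"
  have cut: "sublinear (\<lambda>x. if x \<in> V then q x else 0)" if "sublinear q" for q
    using that subspace_V by (auto simp: sublinear_def subspace_def)
  have "\<exists>m\<in>A. \<forall>a\<in>A. P m a \<longrightarrow> a = m"
  proof (rule predicate_Zorn)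
    show "partial_order_on A (relation_of P A)"
    proof (rule partial_order_on_relation_ofI)
      fix a b c assume "P a b" "P b c"
      then show "P a c"
        unfolding P_def by (meson order.trans)
    next
      fix a b assume ab: "a \<in> A" "b \<in> A" "P a b" "P b a"
      show "a = b"
      proof
        fix x show "a x = b x"
          using ab by (cases "x \<in> V") (auto simp: A_def P_def intro: antisym)
      qed
    qed (simp add: P_def)
  next
    fix C assume "C \<in> Chains (relation_of P A)"
    then have CA: "C \<subseteq> A" and chain: "\<And>q q'. q \<in> C \<Longrightarrow> q' \<in> C \<Longrightarrow> P q q' \<or> P q' q"
      by (auto simp: Chains_def relation_of_def)
    show "\<exists>u\<in>A. \<forall>a\<in>C. P a u"
    proof (cases "C = {}")
      case True
      have "(\<lambda>x. if x \<in> V then p x else 0) \<in> A"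
        using cut[OF p] by (auto simp: A_def)
      then show ?thesis
        using True by blast
    next
      case False
      have sub: "sublinear q" if "q \<in> C" for q
        using that CA by (auto simp: A_def)
      have le: "q x \<le> p x" if "q \<in> C" "x \<in> V" for q x
        using that CA by (auto simp: A_def)
      have lin: "(\<forall>x\<in>V. q x \<le> q' x) \<or> (\<forall>x\<in>V. q' x \<le> q x)" if "q \<in> C" "q' \<in> C" for q q'
        using chain[OF that] by (auto simp: P_def)
      have s: "sublinear (\<lambda>x. INF q\<in>C. q x)"
        by (rule sublinear_INF_chain(1)[of C p]) (use False sub le lin in blast)+
      have l: "(INF q\<in>C. q x) \<le> q x" if "q \<in> C" "x \<in> V" for q x
        by (rule sublinear_INF_chain(2)[of C p]) (use that False sub le lin in blast)+
      define u where "u x = (if x \<in> V then INF q\<in>C. q x else 0)" for x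
      obtain q where q: "q \<in> C" using False by blast
      have "(INF q\<in>C. q x) \<le> p x" if "x \<in> V" for x
        using l[OF q that] le[OF q that] by simp
      then have "u \<in> A"
        using cut[OF s] by (auto simp: A_def u_def[abs_def])
      moreover have "\<forall>a\<in>C. P a u"
        using l by (auto simp: P_def u_def)
      ultimately show ?thesis by blast
    qed
  qed
  then obtain m where m: "m \<in> A" "\<And>a. a \<in> A \<Longrightarrow> P m a \<Longrightarrow> a = m"
    by blast
  show thesis
  proof (rule that[of m])
    fix q x assume q: "sublinear q" "\<And>y. y \<in> V \<Longrightarrow> q y \<le> m y" and x: "x \<in> V"
    have "(\<lambda>x. if x \<in> V then q x else 0) \<in> A"
      using cut[OF q(1)] q(2) m(1) by (force simp: A_def)
    then have "(\<lambda>x. if x \<in> V then q x else 0) = m"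
      using q(2) by (intro m(2)) (auto simp: P_def)
    then show "q x = m x"
      using x by (auto simp: fun_eq_iff split: if_splits)
  qed (use m(1) in \<open>auto simp: A_def\<close>)
qed

lemma hahn_banach:
  assumes p: "sublinear p" and z: "z \<in> V"
  obtains l where "\<And>x y. x \<in> V \<Longrightarrow> y \<in> V \<Longrightarrow> l (x + y) = l x + l y"
    "\<And>c x. x \<in> V \<Longrightarrow> l (scale c x) = c * l x"
    "\<And>x. x \<in> V \<Longrightarrow> l x \<le> p x" "l z = p z"
proof -
  obtain l where l: "sublinear l" "\<And>x. x \<in> V \<Longrightarrow> l x \<le> tilt p z x"
    and minimal: "\<And>q x. sublinear q \<Longrightarrow> (\<And>y. y \<in> V \<Longrightarrow> q y \<le> l y) \<Longrightarrow> x \<in> V \<Longrightarrow> q x = l x"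
    using minimal_sublinear_exists[OF sublinear_tilt[OF p z]] by blast
  have add: "l (x + y) = l x + l y" if "x \<in> V" "y \<in> V" for x y
  proof (rule antisym)
    have "tilt l y x = l x"
      using that l(1) by (intro minimal sublinear_tilt tilt_le_self)
    then show "l x + l y \<le> l (x + y)"
      using tilt_add_le[OF l(1) that(2,1)] by simp
  qed (use sublinear_add[OF l(1)] that in simp)
  have neg: "l (- x) = - l x" if "x \<in> V" for x
    using add[of x "- x"] sublinear_zero[OF l(1)] that subspace_neg[OF subspace_V] by simp
  have scale: "l (scale c x) = c * l x" if "x \<in> V" for c x
  proof (cases "c \<ge> 0")
    case False
    then have "l (scale (- c) x) = - c * l x"
      using that by (intro sublinear_scale[OF l(1)]) auto
    moreover have "l (scale c x) = - l (scale (- c) x)"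
      using neg[of "scale (- c) x"] that subspace_scale[OF subspace_V, of x "- c"] by simp
    ultimately show ?thesis by simp
  qed (use that sublinear_scale[OF l(1)] in simp)
  have le: "l x \<le> p x" if "x \<in> V" for x
    using l(2)[OF that] tilt_le_self[OF p z that] by simp
  \<comment> \<open>The parameter 1 at \<open>- z\<close> bounds the tilt there by
    \<open>p 0 - p z\<close>; additivity then turns this upper bound at \<open>- z\<close> into a
    lower bound at \<open>z\<close>.\<close>
  have "l (- z) \<le> - p z"
    using l(2)[of "- z"] tilt_add_le[OF p z, of "- z"] z sublinear_zero[OF p]
      subspace_neg[OF subspace_V, of z] by simp
  then have "l z = p z"
    using neg[OF z] le[OF z] by simp
  then show thesis
    using that add scale le by blast
qed

end

section \<open>Integration against finitely additive measures\<close>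

lemma Linf_add:
  assumes "X \<in> Linf M" "Y \<in> Linf M"
  shows "(\<lambda>\<omega>. X \<omega> + Y \<omega>) \<in> Linf M"
proof -
  obtain C D where "AE \<omega> in M. norm (X \<omega>) \<le> C" "AE \<omega> in M. norm (Y \<omega>) \<le> D"
    using assms by (auto simp: Linf_def)
  then have "AE \<omega> in M. norm (X \<omega> + Y \<omega>) \<le> C + D"
    by eventually_elim (rule norm_triangle_mono)
  then show ?thesis
    using assms by (auto simp: Linf_def)
qed

text \<open>The operator bound of \<open>h\<close> transports the essential bound, its continuity
  the measurability. Scaling, coordinate projections and the embedding along an axis are all
  instances.\<close>

lemma Linf_bounded_linear:
  assumes "bounded_linear h" "X \<in> Linf M"
  shows "(\<lambda>\<omega>. h (X \<omega>)) \<in> Linf M"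
proof -
  obtain C where C: "AE \<omega> in M. norm (X \<omega>) \<le> C"
    using assms by (auto simp: Linf_def)
  obtain K where K: "K \<ge> 0" "\<And>x. norm (h x) \<le> norm x * K"
    using bounded_linear.nonneg_bounded[OF assms(1)] by blast
  have "AE \<omega> in M. norm (h (X \<omega>)) \<le> C * K"
    using C
  proof eventually_elim
    case (elim \<omega>)
    then show ?case
      using K(2)[of "X \<omega>"] mult_right_mono[OF elim K(1)] by linarith
  qed
  moreover have "(\<lambda>\<omega>. h (X \<omega>)) \<in> borel_measurable M"
    by (rule measurable_compose[OF _ borel_measurable_continuous_onI[OF linear_continuous_on[OF assms(1)]]])
      (use assms(2) in \<open>simp add: Linf_def\<close>)
  ultimately show ?thesis
    by (auto simp: Linf_def)
qed

lemma Linf_const: "(\<lambda>\<omega>. c) \<in> Linf M"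
  by (auto simp: Linf_def)

lemma Linf_scaleR: "X \<in> Linf M \<Longrightarrow> (\<lambda>\<omega>. c *\<^sub>R X \<omega>) \<in> Linf M"
  by (rule Linf_bounded_linear[OF bounded_linear_scaleR_right])

lemma Linf_diff: "X \<in> Linf M \<Longrightarrow> Y \<in> Linf M \<Longrightarrow> (\<lambda>\<omega>. X \<omega> - Y \<omega>) \<in> Linf M"
  using Linf_add[of X M, OF _ Linf_scaleR[of Y M "-1"]] by simp

lemma Linf_component: "X \<in> Linf M \<Longrightarrow> (\<lambda>\<omega>. X \<omega> $ i) \<in> Linf M"
  by (rule Linf_bounded_linear[OF bounded_linear_vec_nth])

lemma Linf_axis:
  fixes \<xi> :: "'a \<Rightarrow> real" and i :: "'n::finite"
  assumes "\<xi> \<in> Linf M"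
  shows "(\<lambda>\<omega>. axis i (\<xi> \<omega>)) \<in> Linf M"
proof (rule Linf_bounded_linear[OF _ assms])
  have "linear (axis i :: real \<Rightarrow> real ^ 'n)"
    by (rule linearI) (auto simp: axis_def vec_eq_iff)
  then show "bounded_linear (axis i :: real \<Rightarrow> real ^ 'n)"
    by (rule linear_conv_bounded_linear[THEN iffD1])
qed

lemma Linf_sum: "(\<And>i. i \<in> I \<Longrightarrow> X i \<in> Linf M) \<Longrightarrow> (\<lambda>\<omega>. \<Sum>i\<in>I. X i \<omega>) \<in> Linf M"
  by (induction I rule: infinite_finite_induct) (auto intro: Linf_const Linf_add)

lemma Linf_simple_function:
  assumes "simple_function M (s :: 'a \<Rightarrow> real)"
  shows "s \<in> Linf M"
proof -
  have "finite (norm ` s ` space M)"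
    using assms by (simp add: simple_function_def)
  then obtain C where "\<And>\<omega>. \<omega> \<in> space M \<Longrightarrow> norm (s \<omega>) \<le> C"
    by (metis bdd_above.unfold bdd_above_finite imageI)
  then show ?thesis
    using assms by (auto simp: Linf_def borel_measurable_simple_function)
qed

lemma Linf_indicator: "A \<in> sets M \<Longrightarrow> (indicator A :: 'a \<Rightarrow> real) \<in> Linf M"
  by (rule Linf_simple_function) simp

section \<open>Finite additivity and integrals of simple functions\<close>

lemma additive_empty:
  fixes \<nu> :: "'a set \<Rightarrow> real"
  assumes "additive (sets M) \<nu>"
  shows "\<nu> {} = 0"
proof -
  have "\<nu> ({} \<union> {}) = \<nu> {} + \<nu> {}"
    using assms unfolding additive_def by blast
  then show ?thesis
    by simp
qed

lemma additive_UN: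
  fixes \<nu> :: "'a set \<Rightarrow> real"
  assumes "additive (sets M) \<nu>" "finite I" "A ` I \<subseteq> sets M" "disjoint_family_on A I"
  shows "\<nu> (\<Union>i\<in>I. A i) = (\<Sum>i\<in>I. \<nu> (A i))"
  using assms(2-)
proof (induction I rule: finite_induct)
  case (insert i I)
  then have "A i \<inter> (\<Union>j\<in>I. A j) = {}"
    by (auto simp: disjoint_family_on_def)
  moreover have "A i \<in> sets M" "(\<Union>j\<in>I. A j) \<in> sets M"
    using insert by auto
  ultimately have "\<nu> (A i \<union> (\<Union>j\<in>I. A j)) = \<nu> (A i) + \<nu> (\<Union>j\<in>I. A j)"
    using assms(1) by (simp add: additive_def)
  then show ?case
    using insert disjoint_family_on_mono[of I "insert i I" A] by auto
qed (simp add: additive_empty[OF assms(1)])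

text \<open>Change of variables: each level set of the composition is a finite disjoint union of
  level sets of \<open>p\<close>. As \<open>p\<close> may take values in any type, several simple
  functions can be integrated over one partition.\<close>

lemma fa_simple_integral_compose:
  assumes \<nu>: "additive (sets M) \<nu>" and p: "simple_function M p"
  shows "fa_simple_integral M \<nu> (\<lambda>\<omega>. h (p \<omega>)) = (\<Sum>z\<in>p ` space M. h z * \<nu> (p -` {z} \<inter> space M))"
proof -
  have fin: "finite (p ` space M)"
    using p by (rule simple_functionD)
  have "\<nu> ((\<lambda>\<omega>. h (p \<omega>)) -` {y} \<inter> space M) = (\<Sum>z\<in>{z \<in> p ` space M. h z = y}. \<nu> (p -` {z} \<inter> space M))" for y
  proof -
    have "(\<lambda>\<omega>. h (p \<omega>)) -` {y} \<inter> space M = (\<Union>z\<in>{z \<in> p ` space M. h z = y}. p -` {z} \<inter> space M)"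
      by auto
    also have "\<nu> \<dots> = (\<Sum>z\<in>{z \<in> p ` space M. h z = y}. \<nu> (p -` {z} \<inter> space M))"
      using fin p by (intro additive_UN[OF \<nu>]) (auto simp: disjoint_family_on_def simple_functionD)
    finally show ?thesis .
  qed
  then have "fa_simple_integral M \<nu> (\<lambda>\<omega>. h (p \<omega>)) =
      (\<Sum>y\<in>h ` p ` space M. \<Sum>z\<in>{z \<in> p ` space M. h z = y}. h z * \<nu> (p -` {z} \<inter> space M))"
    by (simp add: fa_simple_integral_def image_image sum_distrib_left)
  also have "\<dots> = (\<Sum>z\<in>p ` space M. h z * \<nu> (p -` {z} \<inter> space M))"
    using fin by (rule sum.image_gen[symmetric])
  finally show ?thesis .
qed

lemma fa_simple_integral_linear:
  assumes "additive (sets M) \<nu>" "simple_function M s" "simple_function M t"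
  shows "fa_simple_integral M \<nu> (\<lambda>\<omega>. a * s \<omega> + b * t \<omega>) =
    a * fa_simple_integral M \<nu> s + b * fa_simple_integral M \<nu> t"
proof -
  \<comment> \<open>The level sets of the pair are the common refinement of those of
    \<open>s\<close> and \<open>t\<close>; the projections and their linear combination are all
    functions of the pair.\<close>
  have p: "simple_function M (\<lambda>\<omega>. (s \<omega>, t \<omega>))"
    using assms by (intro simple_function_Pair)
  note * = fa_simple_integral_compose[OF assms(1) p]
  show ?thesis
    using *[of "\<lambda>z. a * fst z + b * snd z"] *[of fst] *[of snd]
    by (simp add: sum_distrib_left sum.distrib algebra_simps)
qed

lemma ba_bound:
  assumes "\<nu> \<in> ba M"
  obtains B where "B \<ge> 0" "\<And>A. A \<in> sets M \<Longrightarrow> norm (\<nu> A) \<le> B"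
proof -
  obtain B where B: "\<And>A. A \<in> sets M \<Longrightarrow> norm (\<nu> A) \<le> B"
    using assms by (auto simp: ba_def bounded_iff)
  then have "B \<ge> 0"
    using norm_ge_zero[of "\<nu> {}"] order.trans by blast
  then show thesis
    using B that by blast
qed

text \<open>The factor 2 is the price of passing from a bound on single sets to the total variation:
  the level sets of nonnegative measure and those of negative measure unite to one set each, of
  absolute measure at most \<open>B\<close>.\<close>

lemma fa_simple_integral_bound:
  fixes \<nu> :: "'a set \<Rightarrow> real"
  assumes \<nu>: "\<nu> \<in> ba M" and B: "\<And>A. A \<in> sets M \<Longrightarrow> \<bar>\<nu> A\<bar> \<le> B"
    and s: "simple_function M s" and c: "c \<ge> 0" "AE \<omega> in M. \<bar>s \<omega>\<bar> \<le> c"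
  shows "\<bar>fa_simple_integral M \<nu> s\<bar> \<le> 2 * B * c"
proof -
  define N where "N y = s -` {y} \<inter> space M" for y
  have N: "N y \<in> sets M" for y
    using s by (simp add: N_def simple_functionD)
  have fin: "finite (s ` space M)"
    using s by (rule simple_functionD)
  have UN: "(\<Sum>y\<in>I. \<nu> (N y)) = \<nu> (\<Union>y\<in>I. N y)" "(\<Union>y\<in>I. N y) \<in> sets M" if "I \<subseteq> s ` space M" for I
  proof -
    have "finite I"
      using that fin by (rule finite_subset)
    then show "(\<Sum>y\<in>I. \<nu> (N y)) = \<nu> (\<Union>y\<in>I. N y)"
      using \<nu> N by (intro additive_UN[symmetric]) (auto simp: ba_def disjoint_family_on_def N_def)
    show "(\<Union>y\<in>I. N y) \<in> sets M"
      using \<open>finite I\<close> N by auto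
  qed
  \<comment> \<open>A value exceeding \<open>c\<close> in modulus is taken at most on a null set,
    where the measure vanishes.\<close>
  have term_le: "\<bar>y * \<nu> (N y)\<bar> \<le> c * \<bar>\<nu> (N y)\<bar>" for y
  proof (cases "\<bar>y\<bar> \<le> c")
    case True
    then show ?thesis
      by (simp add: abs_mult mult_right_mono)
  next
    case False
    have "AE \<omega> in M. \<omega> \<notin> N y"
      using c(2) by eventually_elim (use False in \<open>auto simp: N_def\<close>)
    then have "N y \<in> null_sets M"
      using N by (simp add: AE_iff_null_sets)
    then show ?thesis
      using \<nu> c(1) by (simp add: ba_def)
  qed
  define P where "P = {y \<in> s ` space M. \<nu> (N y) \<ge> 0}"
  have "(\<Sum>y\<in>s ` space M. \<bar>\<nu> (N y)\<bar>) = (\<Sum>y\<in>P. \<bar>\<nu> (N y)\<bar>) + (\<Sum>y\<in>s ` space M - P. \<bar>\<nu> (N y)\<bar>)"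
    using fin sum.subset_diff[of P "s ` space M" "\<lambda>y. \<bar>\<nu> (N y)\<bar>"] by (simp add: P_def)
  also have "(\<Sum>y\<in>P. \<bar>\<nu> (N y)\<bar>) = (\<Sum>y\<in>P. \<nu> (N y))"
    by (rule sum.cong) (auto simp: P_def)
  also have "(\<Sum>y\<in>s ` space M - P. \<bar>\<nu> (N y)\<bar>) = - (\<Sum>y\<in>s ` space M - P. \<nu> (N y))"
    by (subst sum_negf[symmetric], rule sum.cong) (auto simp: P_def)
  also have "(\<Sum>y\<in>P. \<nu> (N y)) + - (\<Sum>y\<in>s ` space M - P. \<nu> (N y)) \<le> 2 * B"
    using UN[of P] UN[of "s ` space M - P"] B[of "\<Union>y\<in>P. N y"] B[of "\<Union>y\<in>s ` space M - P. N y"]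
    by (auto simp: P_def)
  finally have total: "(\<Sum>y\<in>s ` space M. \<bar>\<nu> (N y)\<bar>) \<le> 2 * B" .
  have "\<bar>fa_simple_integral M \<nu> s\<bar> \<le> (\<Sum>y\<in>s ` space M. \<bar>y * \<nu> (N y)\<bar>)"
    unfolding fa_simple_integral_def N_def by (rule sum_abs)
  also have "\<dots> \<le> (\<Sum>y\<in>s ` space M. c * \<bar>\<nu> (N y)\<bar>)"
    by (intro sum_mono term_le)
  also have "\<dots> \<le> c * (2 * B)"
    using total c(1) by (simp add: sum_distrib_left[symmetric] mult_left_mono)
  finally show ?thesis
    by (simp add: ac_simps)
qed

section \<open>Essentially uniform limits and the integral of a bounded function\<close>

definition ess_uniform_limit :: "'a measure \<Rightarrow> (nat \<Rightarrow> 'a \<Rightarrow> real) \<Rightarrow> ('a \<Rightarrow> real) \<Rightarrow> bool" where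
  "ess_uniform_limit M s f \<longleftrightarrow> (\<forall>e>0. \<forall>\<^sub>F n in sequentially. AE \<omega> in M. \<bar>s n \<omega> - f \<omega>\<bar> \<le> e)"

lemma has_fa_integral_iff:
  "has_fa_integral M \<mu> f I \<longleftrightarrow>
     (\<exists>s. (\<forall>n. simple_function M (s n)) \<and> ess_uniform_limit M s f \<and>
          (\<lambda>n. fa_simple_integral M \<mu> (s n)) \<longlonglongrightarrow> I)"
  by (simp add: has_fa_integral_def ess_uniform_limit_def)

lemma ess_uniform_limit_add:
  assumes "ess_uniform_limit M s f" "ess_uniform_limit M t g"
  shows "ess_uniform_limit M (\<lambda>n \<omega>. s n \<omega> + t n \<omega>) (\<lambda>\<omega>. f \<omega> + g \<omega>)"
  unfolding ess_uniform_limit_def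
proof (intro allI impI)
  fix e :: real assume "e > 0"
  then have "\<forall>\<^sub>F n in sequentially. AE \<omega> in M. \<bar>s n \<omega> - f \<omega>\<bar> \<le> e / 2"
    "\<forall>\<^sub>F n in sequentially. AE \<omega> in M. \<bar>t n \<omega> - g \<omega>\<bar> \<le> e / 2"
    using assms unfolding ess_uniform_limit_def by (meson half_gt_zero)+
  then show "\<forall>\<^sub>F n in sequentially. AE \<omega> in M. \<bar>s n \<omega> + t n \<omega> - (f \<omega> + g \<omega>)\<bar> \<le> e"
  proof eventually_elim
    case (elim n)
    from elim show ?case
      by eventually_elim linarith
  qed
qed

lemma ess_uniform_limit_simple_exists:
  assumes "f \<in> Linf M"
  obtains s where "\<And>n. simple_function M (s n)" "ess_uniform_limit M s f"
proof -
  obtain C where C: "AE \<omega> in M. \<bar>f \<omega>\<bar> \<le> C" and f[measurable]: "f \<in> borel_measurable M"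
    using assms by (auto simp: Linf_def)
  \<comment> \<open>Rounding down to the grid of mesh \<open>1 / Suc n\<close>. Where
    \<open>f\<close> exceeds its essential bound \<open>C\<close>, which happens only on a null set,
    the default 0 keeps the range finite.\<close>
  define s where "s n \<omega> = (if \<bar>f \<omega>\<bar> \<le> C then \<lfloor>real (Suc n) * f \<omega>\<rfloor> / real (Suc n) else 0)" for n \<omega>
  have "simple_function M (s n)" for n
  proof (rule simple_function_borel_measurable)
    show "s n \<in> borel_measurable M"
      unfolding s_def by measurable
    let ?K = "\<lceil>real (Suc n) * C\<rceil>"
    have "s n \<omega> \<in> insert 0 ((\<lambda>k. of_int k / real (Suc n)) ` {- ?K..?K})" for \<omega>
    proof (cases "\<bar>f \<omega>\<bar> \<le> C")
      case True
      then have "\<bar>real (Suc n) * f \<omega>\<bar> \<le> real (Suc n) * C"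
        by (simp add: abs_mult)
      then have "\<lfloor>real (Suc n) * f \<omega>\<rfloor> \<in> {- ?K..?K}"
        using floor_mono[of "- (real (Suc n) * C)" "real (Suc n) * f \<omega>"]
          order.trans[OF floor_mono floor_le_ceiling, of "real (Suc n) * f \<omega>" "real (Suc n) * C"]
        by (simp add: abs_le_iff floor_minus del: of_nat_Suc)
      then show ?thesis
        using True by (auto simp: s_def)
    qed (simp add: s_def)
    then have "s n ` space M \<subseteq> insert 0 ((\<lambda>k. of_int k / real (Suc n)) ` {- ?K..?K})"
      by blast
    then show "finite (s n ` space M)"
      by (rule finite_subset) simp
  qed
  moreover have "ess_uniform_limit M s f"
    unfolding ess_uniform_limit_def
  proof (intro allI impI)
    fix e :: real assume "e > 0"
    then have "\<forall>\<^sub>F n in sequentially. inverse (real (Suc n)) < e"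
      using LIMSEQ_inverse_real_of_nat by (rule order_tendstoD(2)[rotated])
    then show "\<forall>\<^sub>F n in sequentially. AE \<omega> in M. \<bar>s n \<omega> - f \<omega>\<bar> \<le> e"
    proof eventually_elim
      case (elim n)
      show ?case
        using C
      proof eventually_elim
        case w: (elim \<omega>)
        let ?m = "real (Suc n)"
        have "\<bar>s n \<omega> - f \<omega>\<bar> = \<bar>\<lfloor>?m * f \<omega>\<rfloor> - ?m * f \<omega>\<bar> / ?m"
          using w by (simp add: s_def field_simps abs_divide[symmetric] del: of_nat_Suc abs_divide)
        also have "\<dots> \<le> 1 / ?m"
          by (intro divide_right_mono) linarith+
        finally show ?case
          using elim by (simp add: inverse_eq_divide)
      qed
    qed
  qed
  ultimately show thesis
    by (rule that)
qed

text \<open>Two functions within \<open>c\<close> of \<open>f\<close> are within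
  \<open>2 * c\<close> of each other, and the variation contributes \<open>2 * B\<close>. With
  \<open>s\<close> and \<open>t\<close> from one sequence this gives existence of the integral, with
  two sequences its uniqueness.\<close>

lemma fa_simple_integral_diff_bound:
  fixes \<nu> :: "'a set \<Rightarrow> real"
  assumes \<nu>: "\<nu> \<in> ba M" and B: "\<And>A. A \<in> sets M \<Longrightarrow> \<bar>\<nu> A\<bar> \<le> B"
    and s: "simple_function M s" "AE \<omega> in M. \<bar>s \<omega> - f \<omega>\<bar> \<le> c"
    and t: "simple_function M t" "AE \<omega> in M. \<bar>t \<omega> - f \<omega>\<bar> \<le> c" and c: "c \<ge> 0"
  shows "\<bar>fa_simple_integral M \<nu> s - fa_simple_integral M \<nu> t\<bar> \<le> 4 * B * c"
proof -
  have "AE \<omega> in M. \<bar>1 * s \<omega> + (- 1) * t \<omega>\<bar> \<le> 2 * c"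
    using s(2) t(2) by eventually_elim linarith
  moreover have "simple_function M (\<lambda>\<omega>. 1 * s \<omega> + (- 1) * t \<omega>)"
    using s t by (intro simple_function_add simple_function_mult) auto
  ultimately have "\<bar>fa_simple_integral M \<nu> (\<lambda>\<omega>. 1 * s \<omega> + (- 1) * t \<omega>)\<bar> \<le> 2 * B * (2 * c)"
    using c by (intro fa_simple_integral_bound[OF \<nu> B]) auto
  then show ?thesis
    using \<nu> s t by (subst (asm) fa_simple_integral_linear) (auto simp: ba_def)
qed

lemma has_fa_integral_exists:
  assumes \<nu>: "\<nu> \<in> ba M" and f: "f \<in> Linf M"
  shows "\<exists>I. has_fa_integral M \<nu> f I"
proof -
  obtain s where s: "\<And>n. simple_function M (s n)" "ess_uniform_limit M s f"
    using ess_uniform_limit_simple_exists[OF f] by blast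
  obtain B where B: "B \<ge> 0" "\<And>A. A \<in> sets M \<Longrightarrow> \<bar>\<nu> A\<bar> \<le> B"
    using ba_bound[OF \<nu>] by (metis real_norm_def)
  have "Cauchy (\<lambda>n. fa_simple_integral M \<nu> (s n))"
  proof (rule metric_CauchyI)
    fix e :: real assume e: "e > 0"
    \<comment> \<open>The \<open>+ 1\<close> keeps the denominator positive when
      \<open>B = 0\<close>, and makes the final inequality strict.\<close>
    define c where "c = e / (4 * B + 1)"
    have c: "c > 0" "4 * B * c < e"
      using e B(1) by (auto simp: c_def field_simps)
    then obtain N where N: "\<And>n. n \<ge> N \<Longrightarrow> AE \<omega> in M. \<bar>s n \<omega> - f \<omega>\<bar> \<le> c"
      using s(2) by (auto simp: ess_uniform_limit_def eventually_sequentially)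
    have "dist (fa_simple_integral M \<nu> (s m)) (fa_simple_integral M \<nu> (s n)) < e"
      if "m \<ge> N" "n \<ge> N" for m n
    proof -
      have "\<bar>fa_simple_integral M \<nu> (s m) - fa_simple_integral M \<nu> (s n)\<bar> \<le> 4 * B * c"
        using that N s(1) c(1) by (intro fa_simple_integral_diff_bound[OF \<nu> B(2), where f = f]) auto
      then show ?thesis
        using c(2) by (simp add: dist_real_def)
    qed
    then show "\<exists>N. \<forall>m\<ge>N. \<forall>n\<ge>N. dist (fa_simple_integral M \<nu> (s m)) (fa_simple_integral M \<nu> (s n)) < e"
      by blast
  qed
  then show ?thesis
    using s by (auto simp: has_fa_integral_iff Cauchy_convergent_iff convergent_def)
qed

lemma has_fa_integral_unique:
  assumes \<nu>: "\<nu> \<in> ba M" and "has_fa_integral M \<nu> f I" "has_fa_integral M \<nu> f J"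
  shows "I = J"
proof -
  obtain s where s: "\<And>n. simple_function M (s n)" "ess_uniform_limit M s f"
      "(\<lambda>n. fa_simple_integral M \<nu> (s n)) \<longlonglongrightarrow> I"
    using assms by (auto simp: has_fa_integral_iff)
  obtain t where t: "\<And>n. simple_function M (t n)" "ess_uniform_limit M t f"
      "(\<lambda>n. fa_simple_integral M \<nu> (t n)) \<longlonglongrightarrow> J"
    using assms by (auto simp: has_fa_integral_iff)
  obtain B where B: "B \<ge> 0" "\<And>A. A \<in> sets M \<Longrightarrow> \<bar>\<nu> A\<bar> \<le> B"
    using ba_bound[OF \<nu>] by (metis real_norm_def)
  have "\<bar>I - J\<bar> \<le> 0 + e" if e: "e > 0" for e
  proof -
    define c where "c = e / (4 * B + 1)"
    have c: "c > 0" "4 * B * c \<le> e"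
      using e B(1) by (auto simp: c_def field_simps)
    have "\<forall>\<^sub>F n in sequentially. AE \<omega> in M. \<bar>s n \<omega> - f \<omega>\<bar> \<le> c"
      "\<forall>\<^sub>F n in sequentially. AE \<omega> in M. \<bar>t n \<omega> - f \<omega>\<bar> \<le> c"
      using s(2) t(2) c(1) by (auto simp: ess_uniform_limit_def)
    then have "\<forall>\<^sub>F n in sequentially. \<bar>fa_simple_integral M \<nu> (s n) - fa_simple_integral M \<nu> (t n)\<bar> \<le> 4 * B * c"
      by eventually_elim
        (use s(1) t(1) c(1) in \<open>auto intro!: fa_simple_integral_diff_bound[OF \<nu> B(2), where f = f]\<close>)
    moreover have "(\<lambda>n. \<bar>fa_simple_integral M \<nu> (s n) - fa_simple_integral M \<nu> (t n)\<bar>) \<longlonglongrightarrow> \<bar>I - J\<bar>"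
      by (intro tendsto_intros s(3) t(3))
    ultimately have "\<bar>I - J\<bar> \<le> 4 * B * c"
      by (intro tendsto_upperbound) auto
    then show ?thesis
      using c(2) by simp
  qed
  then have "\<bar>I - J\<bar> \<le> 0"
    by (rule field_le_epsilon)
  then show ?thesis
    by simp
qed

lemma fa_integral_eqI: "\<nu> \<in> ba M \<Longrightarrow> has_fa_integral M \<nu> f I \<Longrightarrow> fa_integral M \<nu> f = I"
  unfolding fa_integral_def by (rule the_equality) (auto intro: has_fa_integral_unique)

lemma has_fa_integral_fa_integral:
  "\<nu> \<in> ba M \<Longrightarrow> f \<in> Linf M \<Longrightarrow> has_fa_integral M \<nu> f (fa_integral M \<nu> f)"
  using has_fa_integral_exists[of \<nu> M f] fa_integral_eqI[of \<nu> M f] by auto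

lemma has_fa_integral_add:
  assumes "additive (sets M) \<nu>" "has_fa_integral M \<nu> f I" "has_fa_integral M \<nu> g J"
  shows "has_fa_integral M \<nu> (\<lambda>\<omega>. f \<omega> + g \<omega>) (I + J)"
proof -
  obtain s where s: "\<And>n. simple_function M (s n)" "ess_uniform_limit M s f"
      "(\<lambda>n. fa_simple_integral M \<nu> (s n)) \<longlonglongrightarrow> I"
    using assms by (auto simp: has_fa_integral_iff)
  obtain t where t: "\<And>n. simple_function M (t n)" "ess_uniform_limit M t g"
      "(\<lambda>n. fa_simple_integral M \<nu> (t n)) \<longlonglongrightarrow> J"
    using assms by (auto simp: has_fa_integral_iff)
  have "fa_simple_integral M \<nu> (\<lambda>\<omega>. s n \<omega> + t n \<omega>) =
      fa_simple_integral M \<nu> (s n) + fa_simple_integral M \<nu> (t n)" for n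
    using fa_simple_integral_linear[OF assms(1) s(1)[of n] t(1)[of n], of 1 1] by simp
  then have "(\<lambda>n. fa_simple_integral M \<nu> (\<lambda>\<omega>. s n \<omega> + t n \<omega>)) \<longlonglongrightarrow> I + J"
    using tendsto_add[OF s(3) t(3)] by simp
  moreover have "simple_function M (\<lambda>\<omega>. s n \<omega> + t n \<omega>)" for n
    by (intro simple_function_add s t)
  ultimately show ?thesis
    unfolding has_fa_integral_iff using ess_uniform_limit_add[OF s(2) t(2)]
    by (intro exI[of _ "\<lambda>n \<omega>. s n \<omega> + t n \<omega>"] conjI allI)
qed

text \<open>Nonemptiness makes the range of the constant function a singleton, so that the defining
  sum has exactly one term.\<close>

lemma has_fa_integral_const:
  assumes "space M \<noteq> {}"
  shows "has_fa_integral M \<nu> (\<lambda>\<omega>. c) (c * \<nu> (space M))"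
proof -
  have "fa_simple_integral M \<nu> (\<lambda>\<omega>. c) = c * \<nu> (space M)"
    using assms by (simp add: fa_simple_integral_def image_constant_conv)
  then show ?thesis
    unfolding has_fa_integral_iff
    by (intro exI[of _ "\<lambda>n \<omega>. c"]) (auto simp: ess_uniform_limit_def)
qed

text \<open>The off-axis components of a vector measure on one axis are zero measures; this
  evaluates their terms in \<open>fa_expectation\<close>. Membership in \<open>Linf M\<close>
  supplies the approximating sequence that the integral is defined through.\<close>

lemma fa_integral_zero_measure:
  assumes "f \<in> Linf M"
  shows "fa_integral M (\<lambda>A. 0) f = 0"
proof (rule fa_integral_eqI)
  obtain s where "\<And>n. simple_function M (s n)" "ess_uniform_limit M s f"
    using ess_uniform_limit_simple_exists[OF assms] by blast
  then show "has_fa_integral M (\<lambda>A. 0) f 0"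
    unfolding has_fa_integral_iff by (intro exI[of _ s]) (auto simp: fa_simple_integral_def)
qed (auto simp: ba_def additive_def bounded_iff)

lemma fa_integral_add_const:
  assumes "\<nu> \<in> ba M" "f \<in> Linf M" "space M \<noteq> {}"
  shows "fa_integral M \<nu> (\<lambda>\<omega>. f \<omega> + c) = fa_integral M \<nu> f + c * \<nu> (space M)"
proof (rule fa_integral_eqI[OF assms(1) has_fa_integral_add])
  show "additive (sets M) \<nu>"
    using assms(1) by (simp add: ba_def)
qed (rule has_fa_integral_fa_integral[OF assms(1,2)] has_fa_integral_const[OF assms(3)])+

section \<open>Bounded linear functionals as finitely additive measures\<close>

text \<open>These are the elements of the norm dual of L infinity, acting on functions in place of
  classes. The bound has two uses: it is continuity, and with \<open>c = 0\<close> it makes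
  \<open>l\<close> blind to null sets.\<close>

locale Linf_functional =
  fixes M :: "'a measure" and l :: "('a \<Rightarrow> real) \<Rightarrow> real" and K :: real
  assumes add: "\<And>f g. f \<in> Linf M \<Longrightarrow> g \<in> Linf M \<Longrightarrow> l (\<lambda>\<omega>. f \<omega> + g \<omega>) = l f + l g"
    and scale: "\<And>f c. f \<in> Linf M \<Longrightarrow> l (\<lambda>\<omega>. c * f \<omega>) = c * l f"
    and bound: "\<And>f c. f \<in> Linf M \<Longrightarrow> AE \<omega> in M. \<bar>f \<omega>\<bar> \<le> c \<Longrightarrow> \<bar>l f\<bar> \<le> K * c"
begin

lemma diff: "f \<in> Linf M \<Longrightarrow> g \<in> Linf M \<Longrightarrow> l (\<lambda>\<omega>. f \<omega> - g \<omega>) = l f - l g"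
  using add[of f "\<lambda>\<omega>. - 1 * g \<omega>"] scale[of g "- 1"] Linf_scaleR[of g M "- 1"] by simp

lemma sum: "(\<And>i. i \<in> I \<Longrightarrow> f i \<in> Linf M) \<Longrightarrow> l (\<lambda>\<omega>. \<Sum>i\<in>I. f i \<omega>) = (\<Sum>i\<in>I. l (f i))"
proof (induction I rule: infinite_finite_induct)
  case (insert i I)
  then show ?case
    using add[of "f i" "\<lambda>\<omega>. \<Sum>i\<in>I. f i \<omega>"] Linf_sum[of I f M] by simp
qed (use scale[OF Linf_const, of 0] in simp_all)

lemma cong_AE:
  assumes "f \<in> Linf M" "g \<in> Linf M" "AE \<omega> in M. f \<omega> = g \<omega>"
  shows "l f = l g"
proof -
  have "AE \<omega> in M. \<bar>f \<omega> - g \<omega>\<bar> \<le> 0"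
    using assms(3) by eventually_elim simp
  then show ?thesis
    using bound[OF Linf_diff, of f g 0] diff[of f g] assms by simp
qed

lemma indicator_in_ba: "(\<lambda>A. l (indicator A)) \<in> ba M"
proof -
  have "l (indicator (A \<union> B)) = l (indicator A) + l (indicator B)"
    if "A \<in> sets M" "B \<in> sets M" "A \<inter> B = {}" for A B
  proof -
    have "(indicator (A \<union> B) :: 'a \<Rightarrow> real) = (\<lambda>\<omega>. indicator A \<omega> + indicator B \<omega>)"
      using that(3) by (auto simp: indicator_def fun_eq_iff)
    then show ?thesis
      using add[OF Linf_indicator Linf_indicator] that by simp
  qed
  moreover have "\<bar>l (indicator A)\<bar> \<le> K" if "A \<in> sets M" for A
    using bound[OF Linf_indicator[OF that], of 1] by (simp add: indicator_def)
  moreover have "l (indicator A) = 0" if "A \<in> null_sets M" for A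
  proof -
    have "AE \<omega> in M. \<bar>indicator A \<omega> :: real\<bar> \<le> 0"
      using AE_not_in[OF that] by eventually_elim simp
    then show ?thesis
      using bound[OF Linf_indicator, of A 0] that by auto
  qed
  ultimately show ?thesis
    by (auto simp: ba_def additive_def bounded_iff)
qed

lemma fa_simple_integral_indicator:
  assumes s: "simple_function M s"
  shows "fa_simple_integral M (\<lambda>A. l (indicator A)) s = l s"
proof -
  let ?N = "\<lambda>y. s -` {y} \<inter> space M"
  let ?g = "\<lambda>y \<omega>. y * indicator (?N y) \<omega> :: real"
  have N: "?N y \<in> sets M" for y
    using s by (rule simple_functionD)
  have g: "?g y \<in> Linf M" for y
    using Linf_scaleR[OF Linf_indicator[OF N], where c = y] by simp
  have "s \<omega> = (\<Sum>y\<in>s ` space M. ?g y \<omega>)" if "\<omega> \<in> space M" for \<omega>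
  proof -
    have "(\<Sum>y\<in>s ` space M. ?g y \<omega>) = (\<Sum>y\<in>s ` space M. if y = s \<omega> then y else 0)"
      using that by (intro sum.cong) (auto simp: indicator_def)
    also have "\<dots> = s \<omega>"
      using that simple_functionD(1)[OF s] by simp
    finally show ?thesis by simp
  qed
  \<comment> \<open>The expansion into level sets agrees with \<open>s\<close> only on
    \<open>space M\<close>; \<open>cong_AE\<close> lets \<open>l\<close> ignore the values
    elsewhere.\<close>
  then have "l s = l (\<lambda>\<omega>. \<Sum>y\<in>s ` space M. ?g y \<omega>)"
    by (intro cong_AE Linf_simple_function[OF s] Linf_sum g AE_I2)
  also have "\<dots> = (\<Sum>y\<in>s ` space M. l (?g y))"
    using g by (rule sum)
  also have "\<dots> = (\<Sum>y\<in>s ` space M. y * l (indicator (?N y)))"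
    using scale[OF Linf_indicator[OF N]] by simp
  finally show ?thesis
    by (simp add: fa_simple_integral_def)
qed

text \<open>The integral is a limit of its values on simple functions, where it equals
  \<open>l\<close>, and \<open>bound\<close> carries \<open>l\<close> to the same limit. With
  \<open>indicator_in_ba\<close> this represents every bounded functional by a measure.\<close>

lemma fa_integral_indicator:
  assumes f: "f \<in> Linf M"
  shows "fa_integral M (\<lambda>A. l (indicator A)) f = l f"
proof -
  obtain s where s: "\<And>n. simple_function M (s n)" "ess_uniform_limit M s f"
    using ess_uniform_limit_simple_exists[OF f] by blast
  \<comment> \<open>The zero function with majorant 1 forces this sign.\<close>
  have "K \<ge> 0"
    using bound[OF Linf_const[of 0], of 1] by simp
  have "(\<lambda>n. l (s n)) \<longlonglongrightarrow> l f"
  proof (rule tendstoI)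
    fix e :: real assume e: "e > 0"
    define c where "c = e / (K + 1)"
    have c: "c > 0" "K * c < e"
      using e \<open>K \<ge> 0\<close> by (auto simp: c_def field_simps)
    have "\<forall>\<^sub>F n in sequentially. AE \<omega> in M. \<bar>s n \<omega> - f \<omega>\<bar> \<le> c"
      using s(2) c(1) by (simp add: ess_uniform_limit_def)
    then show "\<forall>\<^sub>F n in sequentially. dist (l (s n)) (l f) < e"
    proof eventually_elim
      case (elim n)
      have "\<bar>l (s n) - l f\<bar> \<le> K * c"
        using bound[OF Linf_diff elim] diff[of "s n" f] s(1) f by (simp add: Linf_simple_function)
      then show ?case
        using c(2) by (simp add: dist_real_def)
    qed
  qed
  then have "has_fa_integral M (\<lambda>A. l (indicator A)) f (l f)"
    using s unfolding has_fa_integral_iff by (intro exI[of _ s]) (simp add: fa_simple_integral_indicator)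
  then show ?thesis
    by (rule fa_integral_eqI[OF indicator_in_ba])
qed

end

section \<open>Coherent risk measures\<close>

context
  fixes M :: "'a measure" and \<rho> :: "('a \<Rightarrow> 'b::ordered_euclidean_space) \<Rightarrow> 'b"
  assumes coherent: "coherent_risk_measure M \<rho>"
begin

lemma coherent_const: "X \<in> Linf M \<Longrightarrow> AE \<omega> in M. X \<omega> = x \<Longrightarrow> \<rho> X = - x"
  and coherent_translate: "X \<in> Linf M \<Longrightarrow> \<rho> (\<lambda>\<omega>. X \<omega> + y) = \<rho> X - y"
  and coherent_antimono: "X \<in> Linf M \<Longrightarrow> Y \<in> Linf M \<Longrightarrow> AE \<omega> in M. Y \<omega> \<le> X \<omega> \<Longrightarrow> \<rho> X \<le> \<rho> Y"
  and coherent_scale: "X \<in> Linf M \<Longrightarrow> t > 0 \<Longrightarrow> \<rho> (\<lambda>\<omega>. t *\<^sub>R X \<omega>) = t *\<^sub>R \<rho> X"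
  and coherent_subadditive: "X \<in> Linf M \<Longrightarrow> Y \<in> Linf M \<Longrightarrow> \<rho> (\<lambda>\<omega>. X \<omega> + Y \<omega>) \<le> \<rho> X + \<rho> Y"
  using coherent by (simp_all add: coherent_risk_measure_def)

end

section \<open>Reduction to the marginals\<close>

lemma coherent_component_le:
  fixes X Y :: "'a \<Rightarrow> real ^ 'd::finite"
  assumes \<rho>: "coherent_risk_measure M \<rho>" and X: "X \<in> Linf M" and Y: "Y \<in> Linf M"
    and eq: "AE \<omega> in M. X \<omega> $ i = Y \<omega> $ i"
  shows "\<rho> X $ i \<le> \<rho> Y $ i"
proof -
  define D where "D \<omega> = X \<omega> - Y \<omega>" for \<omega>
  have D: "D \<in> Linf M"
    using Linf_diff[OF X Y] by (simp add: D_def[abs_def])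
  then obtain C where C: "AE \<omega> in M. norm (D \<omega>) \<le> C"
    by (auto simp: Linf_def)
  \<comment> \<open>\<open>\<rho> X \<le> \<rho> Y + \<rho> D\<close>, and \<open>D\<close> dominates a constant vector that vanishes in coordinate \<open>i\<close>.\<close>
  define v :: "real ^ 'd" where "v = (\<chi> j. if j = i then 0 else - C)"
  have "AE \<omega> in M. v \<le> D \<omega>"
    using C eq
  proof eventually_elim
    case (elim \<omega>)
    have "- C \<le> D \<omega> $ j" for j
      using component_le_norm_cart[of "D \<omega>" j] elim(1) by linarith
    then show ?case
      using elim(2) by (auto simp: v_def less_eq_vec_def D_def)
  qed
  then have "\<rho> D \<le> \<rho> (\<lambda>\<omega>. v)"
    by (intro coherent_antimono[OF \<rho> D Linf_const])
  also have "\<rho> (\<lambda>\<omega>. v) = - v"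
    by (intro coherent_const[OF \<rho> Linf_const]) simp
  finally have "\<rho> D $ i \<le> (- v) $ i"
    unfolding less_eq_vec_def by blast
  then have "\<rho> D $ i \<le> 0"
    by (simp add: v_def)
  moreover have "\<rho> X \<le> \<rho> Y + \<rho> D"
    using coherent_subadditive[OF \<rho> Y D] by (simp add: D_def)
  then have "\<rho> X $ i \<le> (\<rho> Y + \<rho> D) $ i"
    unfolding less_eq_vec_def by blast
  ultimately show ?thesis
    by simp
qed

lemma coherent_component_eq:
  fixes X Y :: "'a \<Rightarrow> real ^ 'd::finite"
  assumes "coherent_risk_measure M \<rho>" "X \<in> Linf M" "Y \<in> Linf M"
    and "AE \<omega> in M. X \<omega> $ i = Y \<omega> $ i"
  shows "\<rho> X $ i = \<rho> Y $ i"
proof (rule antisym)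
  have "AE \<omega> in M. Y \<omega> $ i = X \<omega> $ i"
    using assms(4) by eventually_elim simp
  then show "\<rho> Y $ i \<le> \<rho> X $ i"
    by (rule coherent_component_le[OF assms(1,3,2)])
qed (rule coherent_component_le[OF assms])

text \<open>By \<open>coherent_component_eq\<close> any essentially bounded filler in the other
  coordinates would give the same value on \<open>Linf M\<close>; the filler 0 makes the embedding
  linear.\<close>

definition marginal_risk ::
    "(('a \<Rightarrow> real ^ 'd::finite) \<Rightarrow> real ^ 'd) \<Rightarrow> 'd \<Rightarrow> ('a \<Rightarrow> real) \<Rightarrow> real" where
  "marginal_risk \<rho> i \<xi> = \<rho> (\<lambda>\<omega>. axis i (\<xi> \<omega>)) $ i"

lemma marginal_risk_component:
  assumes "coherent_risk_measure M \<rho>" "X \<in> Linf M"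
  shows "marginal_risk \<rho> i (\<lambda>\<omega>. X \<omega> $ i) = \<rho> X $ i"
  unfolding marginal_risk_def
  by (rule coherent_component_eq[OF assms(1) Linf_axis[OF Linf_component[OF assms(2)]] assms(2)]) simp

text \<open>Embedding along axis \<open>i\<close> is linear, monotone and sends constants to
  constants, so each axiom is coordinate \<open>i\<close> of the same axiom for
  \<open>\<rho>\<close>.\<close>

lemma coherent_marginal_risk:
  fixes \<rho> :: "('a \<Rightarrow> real ^ 'd::finite) \<Rightarrow> real ^ 'd"
  assumes \<rho>: "coherent_risk_measure M \<rho>"
  shows "coherent_risk_measure M (marginal_risk \<rho> i)"
proof -
  have add: "axis i (x + y) = axis i x + axis i y" for x y :: real
    by (simp add: axis_def vec_eq_iff)
  have scale: "axis i (t * x) = t *\<^sub>R axis i x" for t x :: real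
    by (simp add: axis_def vec_eq_iff)
  have "marginal_risk \<rho> i \<xi> = - x" if "\<xi> \<in> Linf M" "AE \<omega> in M. \<xi> \<omega> = x" for \<xi> x
  proof -
    have "AE \<omega> in M. axis i (\<xi> \<omega>) = axis i x"
      using that(2) by eventually_elim simp
    then show ?thesis
      using coherent_const[OF \<rho> Linf_axis[OF that(1)]] by (simp add: marginal_risk_def)
  qed
  moreover have "marginal_risk \<rho> i (\<lambda>\<omega>. \<xi> \<omega> + y) = marginal_risk \<rho> i \<xi> - y"
    if "\<xi> \<in> Linf M" for \<xi> y
    using coherent_translate[OF \<rho> Linf_axis[OF that]] by (simp add: marginal_risk_def add)
  moreover have "marginal_risk \<rho> i \<xi> \<le> marginal_risk \<rho> i \<eta>"
    if "\<xi> \<in> Linf M" "\<eta> \<in> Linf M" "AE \<omega> in M. \<eta> \<omega> \<le> \<xi> \<omega>" for \<xi> \<eta>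
  proof -
    have "AE \<omega> in M. axis i (\<eta> \<omega>) \<le> axis i (\<xi> \<omega>)"
      using that(3) by eventually_elim (simp add: less_eq_vec_def axis_def)
    then show ?thesis
      using coherent_antimono[OF \<rho> Linf_axis[OF that(1)] Linf_axis[OF that(2)]]
      by (simp add: marginal_risk_def less_eq_vec_def)
  qed
  moreover have "marginal_risk \<rho> i (\<lambda>\<omega>. t *\<^sub>R \<xi> \<omega>) = t *\<^sub>R marginal_risk \<rho> i \<xi>"
    if "\<xi> \<in> Linf M" "t > 0" for \<xi> t
    using coherent_scale[OF \<rho> Linf_axis[OF that(1)] that(2)] by (simp add: marginal_risk_def scale)
  moreover have "marginal_risk \<rho> i (\<lambda>\<omega>. \<xi> \<omega> + \<eta> \<omega>) \<le> marginal_risk \<rho> i \<xi> + marginal_risk \<rho> i \<eta>"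
    if "\<xi> \<in> Linf M" "\<eta> \<in> Linf M" for \<xi> \<eta>
    using coherent_subadditive[OF \<rho> Linf_axis[OF that(1)] Linf_axis[OF that(2)]]
    by (simp add: marginal_risk_def less_eq_vec_def add)
  ultimately show ?thesis
    unfolding coherent_risk_measure_def by blast
qed

section \<open>Attained dual representation in one dimension\<close>

text \<open>The dominating functional is the risk of \<open>- f\<close> rather than of
  \<open>f\<close>, so that \<open>l\<close> has the sign of an expectation and its upper bound at
  \<open>- f\<close> reads as the lower bound \<open>- r f\<close> at \<open>f\<close>. Hahn-Banach
  is applied at \<open>- \<xi>\<close>, because it is the lower bound that has to be attained at
  \<open>\<xi>\<close>.\<close>

lemma coherent_dual_attained:
  fixes r :: "('a \<Rightarrow> real) \<Rightarrow> real"
  assumes r: "coherent_risk_measure M r" and \<xi>: "\<xi> \<in> Linf M"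
  obtains \<nu> where "\<nu> \<in> ba M" "\<nu> (space M) = 1" "\<And>f. f \<in> Linf M \<Longrightarrow> - r f \<le> fa_integral M \<nu> f"
    "fa_integral M \<nu> \<xi> = - r \<xi>"
proof -
  interpret real_subspace "\<lambda>c f \<omega>. c * f \<omega>" "Linf M :: ('a \<Rightarrow> real) set"
  proof (unfold_locales)
    interpret vector_space "\<lambda>(c::real) (f::'a \<Rightarrow> real) \<omega>. c * f \<omega>"
      by unfold_locales (auto simp: fun_eq_iff algebra_simps)
    show "subspace (Linf M :: ('a \<Rightarrow> real) set)"
      using Linf_const[of "0 :: real" M] Linf_add[of _ M] Linf_scaleR[of "_ :: 'a \<Rightarrow> real" M]
      by (auto simp: subspace_def plus_fun_def zero_fun_def)
  qed (auto simp: fun_eq_iff algebra_simps)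
  have neg: "(\<lambda>\<omega>. - f \<omega>) \<in> Linf M" if "f \<in> Linf M" for f :: "'a \<Rightarrow> real"
    using Linf_scaleR[OF that, of "- 1"] by simp
  have "sublinear (\<lambda>f. r (\<lambda>\<omega>. - f \<omega>))"
  proof (rule sublinearI)
    fix f g :: "'a \<Rightarrow> real" assume "f \<in> Linf M" "g \<in> Linf M"
    then show "r (\<lambda>\<omega>. - (f + g) \<omega>) \<le> r (\<lambda>\<omega>. - f \<omega>) + r (\<lambda>\<omega>. - g \<omega>)"
      using coherent_subadditive[OF r neg neg, of f g] by (simp add: algebra_simps)
  next
    fix f :: "'a \<Rightarrow> real" and t :: real assume "f \<in> Linf M" "t > 0"
    then show "r (\<lambda>\<omega>. - (t * f \<omega>)) \<le> t * r (\<lambda>\<omega>. - f \<omega>)"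
      using coherent_scale[OF r neg, of f t] by simp
  qed
  then obtain l where l_add: "\<And>f g. f \<in> Linf M \<Longrightarrow> g \<in> Linf M \<Longrightarrow> l (f + g) = l f + l g"
    and l_scale: "\<And>c f. f \<in> Linf M \<Longrightarrow> l (\<lambda>\<omega>. c * f \<omega>) = c * l f"
    and l_le: "\<And>f. f \<in> Linf M \<Longrightarrow> l f \<le> r (\<lambda>\<omega>. - f \<omega>)"
    and l_eq: "l (\<lambda>\<omega>. - \<xi> \<omega>) = r (\<lambda>\<omega>. - (- \<xi> \<omega>))"
    using hahn_banach[OF _ neg[OF \<xi>]] by blast
  have l_neg: "l (\<lambda>\<omega>. - f \<omega>) = - l f" if "f \<in> Linf M" for f
    using l_scale[OF that, of "- 1"] by simp
  have l_ge: "- r f \<le> l f" if "f \<in> Linf M" for f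
    using l_le[OF neg[OF that]] l_neg[OF that] by simp
  \<comment> \<open>Comparison with the constant \<open>- c\<close>, whose risk is \<open>c\<close>.
    Used for both \<open>f\<close> and \<open>- f\<close>, it shows that \<open>l\<close> has norm
    at most 1.\<close>
  have r_le: "r f \<le> c" if "f \<in> Linf M" "AE \<omega> in M. - c \<le> f \<omega>" for f c
    using coherent_antimono[OF r that(1) Linf_const that(2)]
      coherent_const[OF r Linf_const, of "- c" "- c"] by simp
  interpret Linf_functional M l 1
  proof
    fix f :: "'a \<Rightarrow> real" and c assume f: "f \<in> Linf M" "AE \<omega> in M. \<bar>f \<omega>\<bar> \<le> c"
    have "AE \<omega> in M. - c \<le> f \<omega>" "AE \<omega> in M. - c \<le> - f \<omega>"
      using f(2) by (eventually_elim, linarith)+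
    then have "r f \<le> c" "r (\<lambda>\<omega>. - f \<omega>) \<le> c"
      using r_le f(1) neg by blast+
    then show "\<bar>l f\<bar> \<le> 1 * c"
      using l_le[OF f(1)] l_ge[OF f(1)] by linarith
  next
    fix f g :: "'a \<Rightarrow> real" assume "f \<in> Linf M" "g \<in> Linf M"
    then show "l (\<lambda>\<omega>. f \<omega> + g \<omega>) = l f + l g"
      using l_add[of f g] by (simp add: plus_fun_def)
  qed (rule l_scale)
  let ?\<nu> = "\<lambda>A. l (indicator A)"
  \<comment> \<open>The constant 1 has risk - 1 and its negative has risk 1, so the upper and lower
    bounds on \<open>l\<close> meet.\<close>
  have "l (indicator (space M)) = 1"
  proof (rule antisym)
    let ?u = "indicator (space M) :: 'a \<Rightarrow> real"
    have u: "?u \<in> Linf M"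
      by (rule Linf_indicator) simp
    have "r ?u = - 1" "r (\<lambda>\<omega>. - ?u \<omega>) = - (- 1)"
      by (rule coherent_const[OF r]; use u neg[OF u] in auto)+
    then show "l ?u \<le> 1" "1 \<le> l ?u"
      using l_le[OF u] l_ge[OF u] by simp_all
  qed
  moreover have "l \<xi> = - r \<xi>"
    using l_eq l_neg[OF \<xi>] by simp
  ultimately show thesis
    using that[of ?\<nu>] indicator_in_ba fa_integral_indicator l_ge \<xi> by simp
qed

section \<open>Polar sets along one axis\<close>

lemma fa_expectation_axis:
  assumes "X \<in> Linf M"
  shows "fa_expectation M (\<lambda>A. axis i (\<nu> A)) X = fa_integral M \<nu> (\<lambda>\<omega>. X \<omega> $ i)"
proof -
  have "fa_integral M (\<lambda>A. axis i (\<nu> A) $ j) (\<lambda>\<omega>. X \<omega> $ j) =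
      (if j = i then fa_integral M \<nu> (\<lambda>\<omega>. X \<omega> $ i) else 0)" for j
    using fa_integral_zero_measure[OF Linf_component[OF assms]] by (simp add: axis_def)
  then show ?thesis
    by (simp add: fa_expectation_def)
qed

lemma ba_axis:
  assumes "\<nu> \<in> ba M"
  shows "(\<lambda>A. axis i (\<nu> A) :: real ^ 'd::finite) \<in> ba M"
proof -
  have "axis i (x + y) = (axis i x + axis i y :: real ^ 'd)" for x y :: real
    by (simp add: axis_def vec_eq_iff)
  moreover have "norm (axis i x :: real ^ 'd) = \<bar>x\<bar>" for x
  proof -
    have "axis i x = x *\<^sub>R (axis i 1 :: real ^ 'd)"
      by (simp add: axis_def vec_eq_iff)
    then show ?thesis
      by (simp add: norm_axis_1)
  qed
  ultimately show ?thesis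
    using assms by (auto simp: ba_def additive_def bounded_iff)
qed

text \<open>Only coordinate \<open>i\<close> contributes to the expectation under a measure on axis
  \<open>i\<close>: since \<open>\<A>\<close> lies in \<open>Linf M\<close>, the integrals of the
  other coordinates against the zero measure are 0.\<close>

lemma polar_marginal_iff:
  assumes "\<A> \<subseteq> Linf M"
  shows "\<nu> \<in> polar_marginal M \<A> i \<longleftrightarrow>
    \<nu> \<in> ba M \<and> \<nu> (space M) = 1 \<and> (\<forall>X\<in>\<A>. fa_integral M \<nu> (\<lambda>\<omega>. X \<omega> $ i) \<ge> 0)"
  using assms fa_expectation_axis[of _ M i \<nu>] ba_axis[of \<nu> M i]
  by (auto simp: polar_marginal_def polar_set_def subset_eq)

theorem mainTheorem7:
  fixes M :: "'a measure"
    and \<rho> :: "('a \<Rightarrow> real ^ 'd::finite) \<Rightarrow> real ^ 'd"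
  assumes "prob_space M"
    and "coherent_risk_measure M \<rho>"
  shows "(\<forall>X\<in>Linf M. \<forall>i.
            ereal (\<rho> X $ i) =
              - (INF \<nu>\<in>polar_marginal M (acceptance_set M \<rho>) i.
                   ereal (fa_integral M \<nu> (\<lambda>\<omega>. X \<omega> $ i)))) \<and>
         (\<exists>r :: 'd \<Rightarrow> ('a \<Rightarrow> real) \<Rightarrow> real.
            (\<forall>i. coherent_risk_measure M (r i)) \<and>
            (\<forall>X\<in>Linf M. \<rho> X = (\<chi> i. r i (\<lambda>\<omega>. X \<omega> $ i))))"
proof (intro conjI ballI allI)
  note \<rho> = assms(2)
  interpret prob_space M by fact
  fix X :: "'a \<Rightarrow> real ^ 'd" and i assume X: "X \<in> Linf M"
  let ?A = "acceptance_set M \<rho>"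
  have A: "?A \<subseteq> Linf M"
    by (auto simp: acceptance_set_def)
  note polar_iff = polar_marginal_iff[OF A]
  \<comment> \<open>The infimum lives in the extended reals. Its finiteness is part of the claim:
    one inequality exhibits a member of the family, the other bounds all members from below.\<close>
  have "(INF \<nu>\<in>polar_marginal M ?A i. ereal (fa_integral M \<nu> (\<lambda>\<omega>. X \<omega> $ i))) = ereal (- \<rho> X $ i)"
  proof (rule antisym)
    obtain \<nu> where \<nu>: "\<nu> \<in> ba M" "\<nu> (space M) = 1"
        "\<And>f. f \<in> Linf M \<Longrightarrow> - marginal_risk \<rho> i f \<le> fa_integral M \<nu> f"
        "fa_integral M \<nu> (\<lambda>\<omega>. X \<omega> $ i) = - marginal_risk \<rho> i (\<lambda>\<omega>. X \<omega> $ i)"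
      using coherent_dual_attained[OF coherent_marginal_risk[OF \<rho>] Linf_component[OF X]] by blast
    \<comment> \<open>Acceptability of \<open>Y\<close> enters only through
      \<open>\<rho> Y $ i \<le> 0\<close>, which makes the lower bound of the integral of coordinate
      \<open>i\<close> nonnegative.\<close>
    have "0 \<le> fa_integral M \<nu> (\<lambda>\<omega>. Y \<omega> $ i)" if "Y \<in> ?A" for Y
    proof -
      have Y: "Y \<in> Linf M" "\<rho> Y $ i \<le> 0"
        using that by (auto simp: acceptance_set_def less_eq_vec_def)
      then show ?thesis
        using \<nu>(3)[OF Linf_component[OF Y(1)], of i] marginal_risk_component[OF \<rho> Y(1), of i] by simp
    qed
    then have "\<nu> \<in> polar_marginal M ?A i"
      using \<nu>(1,2) by (simp add: polar_iff)
    then show "(INF \<nu>\<in>polar_marginal M ?A i. ereal (fa_integral M \<nu> (\<lambda>\<omega>. X \<omega> $ i))) \<le> ereal (- \<rho> X $ i)"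
      using \<nu>(4) marginal_risk_component[OF \<rho> X, of i] by (intro INF_lower2[of \<nu>]) auto
  next
    define Y where "Y \<omega> = X \<omega> + \<rho> X" for \<omega>
    have "Y \<in> ?A"
      using coherent_translate[OF \<rho> X, of "\<rho> X"] Linf_add[OF X Linf_const, of "\<rho> X"]
      by (simp add: acceptance_set_def Y_def[abs_def])
    have "- \<rho> X $ i \<le> fa_integral M \<nu> (\<lambda>\<omega>. X \<omega> $ i)" if "\<nu> \<in> polar_marginal M ?A i" for \<nu>
    proof -
      have \<nu>: "\<nu> \<in> ba M" "\<nu> (space M) = 1" "0 \<le> fa_integral M \<nu> (\<lambda>\<omega>. Y \<omega> $ i)"
        using that \<open>Y \<in> ?A\<close> by (auto simp: polar_iff)
      \<comment> \<open>Total mass 1 lets the constant \<open>\<rho> X $ i\<close> leave the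
        integral with coefficient 1.\<close>
      have "fa_integral M \<nu> (\<lambda>\<omega>. Y \<omega> $ i) = fa_integral M \<nu> (\<lambda>\<omega>. X \<omega> $ i) + \<rho> X $ i"
        using fa_integral_add_const[OF \<nu>(1) Linf_component[OF X] not_empty] \<nu>(2) by (simp add: Y_def)
      then show ?thesis
        using \<nu>(3) by simp
    qed
    then show "ereal (- \<rho> X $ i) \<le> (INF \<nu>\<in>polar_marginal M ?A i. ereal (fa_integral M \<nu> (\<lambda>\<omega>. X \<omega> $ i)))"
      by (intro INF_greatest) simp
  qed
  then show "ereal (\<rho> X $ i) =
      - (INF \<nu>\<in>polar_marginal M ?A i. ereal (fa_integral M \<nu> (\<lambda>\<omega>. X \<omega> $ i)))"
    by simp
next
  show "\<exists>r :: 'd \<Rightarrow> ('a \<Rightarrow> real) \<Rightarrow> real.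
      (\<forall>i. coherent_risk_measure M (r i)) \<and>
      (\<forall>X\<in>Linf M. \<rho> X = (\<chi> i. r i (\<lambda>\<omega>. X \<omega> $ i)))"
    using coherent_marginal_risk[OF assms(2)] marginal_risk_component[OF assms(2)]
    by (intro exI[of _ "marginal_risk \<rho>"]) (simp add: vec_eq_iff)
qed

end
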